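(* Let $C=\{1,2,\ldots,N\}$ and let $\rho$ be a permutation of $C$. Let $\mathbb{M}'_\rho=\{M\in GL_N(\mathbb{R})\mid M^\rho=M\}$ be the set of all invertible real $N\times N$ matrices for which $\rho$ is a state symmetry. Then $\mathbb{M}'_\rho$ forms a group with respect to matrix multiplication.
   Context: For a permutation $\rho$ of $C=\{1,\ldots,N\}$ and a real $N\times N$ matrix $M=(m_{ij})$, the reordered matrix is $M^\rho:=(m_{\rho(i)\,\rho(j)})_{i,j}$. The permutation $\rho$ is a state symmetry of $M$ if $M^\rho=M$. *)

theory Defs
  imports "HOL-Analysis.Determinants" "HOL-Algebra.Group"
begin

text \<open>
  The state set \<open>C = {1, \<dots>, N}\<close> is the finite index type \<open>'n\<close>, with \<open>N = CARD('n)\<close>;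
  a permutation of \<open>C\<close> is a \<open>\<rho>\<close> with \<open>\<rho> permutes UNIV\<close>.
\<close>

definition reorder_matrix :: "('n \<Rightarrow> 'n) \<Rightarrow> real ^ 'n ^ 'n \<Rightarrow> real ^ 'n ^ 'n" where
  "reorder_matrix \<rho> M = (\<chi> i j. M $ \<rho> i $ \<rho> j)"

definition state_symmetry :: "('n \<Rightarrow> 'n) \<Rightarrow> real ^ 'n ^ 'n \<Rightarrow> bool" where
  "state_symmetry \<rho> M \<longleftrightarrow> \<rho> permutes UNIV \<and> reorder_matrix \<rho> M = M"

definition GL_state_symmetry :: "('n::finite \<Rightarrow> 'n) \<Rightarrow> (real ^ 'n ^ 'n) set" where
  "GL_state_symmetry \<rho> = {M. invertible M \<and> state_symmetry \<rho> M}"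

end

theory Submission imports Defs
begin

text \<open>
  Reordering by a permutation \<open>\<rho>\<close> is conjugation by a permutation matrix, hence an automorphism of
  the matrix algebra: it preserves products, because the inner summation index can be renamed
  along the bijection \<open>\<rho>\<close>, and it preserves the identity, because \<open>\<rho>\<close> is injective. The invertible
  matrices fixed by \<open>\<rho>\<close> are thus the fixed points of an automorphism acting on the general linear
  group, and fixed points of an automorphism form a subgroup. Working with the two preservation
  laws directly avoids introducing the permutation matrix itself.
\<close>

lemma reorder_matrix_mult:
  fixes A B :: "real ^ 'n::finite ^ 'n"
  assumes "\<rho> permutes UNIV"
  shows "reorder_matrix \<rho> (A ** B) = reorder_matrix \<rho> A ** reorder_matrix \<rho> B"
proof -
  have "(\<Sum>k\<in>UNIV. A $ \<rho> i $ k * B $ k $ \<rho> j) = (\<Sum>k\<in>UNIV. A $ \<rho> i $ \<rho> k * B $ \<rho> k $ \<rho> j)" for i j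
    using sum.reindex_bij_betw[OF permutes_imp_bij[OF assms], of "\<lambda>k. A $ \<rho> i $ k * B $ k $ \<rho> j"]
    by simp
  then show ?thesis
    by (simp add: reorder_matrix_def matrix_matrix_mult_def vec_eq_iff)
qed

lemma reorder_matrix_mat_1:
  fixes \<rho> :: "'n::finite \<Rightarrow> 'n"
  assumes "\<rho> permutes UNIV"
  shows "reorder_matrix \<rho> (mat 1) = mat 1"
  using permutes_inj[OF assms] by (simp add: reorder_matrix_def mat_def vec_eq_iff inj_eq)

text \<open>
  Applying the reordering to \<open>B ** A = mat 1\<close> shows that the reordered \<open>B\<close> is again a left inverse
  of the fixed matrix \<open>A\<close>; uniqueness of inverses then forces it to equal \<open>B\<close>.
\<close>

lemma reorder_matrix_fixes_inverse:
  fixes A B :: "real ^ 'n::finite ^ 'n"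
  assumes \<rho>: "\<rho> permutes UNIV"
    and fixed: "reorder_matrix \<rho> A = A"
    and inverse: "A ** B = mat 1" "B ** A = mat 1"
  shows "reorder_matrix \<rho> B = B"
proof -
  have "reorder_matrix \<rho> B ** A = mat 1"
    using reorder_matrix_mult[OF \<rho>, of B A] reorder_matrix_mat_1[OF \<rho>] fixed inverse(2) by simp
  then have "reorder_matrix \<rho> B ** (A ** B) = B"
    by (simp add: matrix_mul_assoc)
  then show ?thesis
    using inverse(1) by simp
qed

theorem theorem4:
  fixes \<rho> :: "'n::finite \<Rightarrow> 'n"
  assumes "\<rho> permutes UNIV"
  shows "group \<lparr>carrier = GL_state_symmetry \<rho>, mult = (**), one = mat 1\<rparr>"
proof (rule groupI, simp_all)
  have mem: "M \<in> GL_state_symmetry \<rho> \<longleftrightarrow> invertible M \<and> reorder_matrix \<rho> M = M" for M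
    using assms by (simp add: GL_state_symmetry_def state_symmetry_def)
  show "A ** B \<in> GL_state_symmetry \<rho>"
    if "A \<in> GL_state_symmetry \<rho>" "B \<in> GL_state_symmetry \<rho>" for A B
    using that by (simp add: mem invertible_mult reorder_matrix_mult[OF assms])
  show "mat 1 \<in> GL_state_symmetry \<rho>"
    using reorder_matrix_mat_1[OF assms] by (auto simp: mem invertible_def intro: exI[of _ "mat 1"])
  show "(A ** B) ** C = A ** (B ** C)" for A B C :: "real ^ 'n ^ 'n"
    by (simp add: matrix_mul_assoc)
  show "\<exists>B\<in>GL_state_symmetry \<rho>. B ** A = mat 1" if "A \<in> GL_state_symmetry \<rho>" for A
  proof -
    obtain B where B: "A ** B = mat 1" "B ** A = mat 1"
      using \<open>A \<in> GL_state_symmetry \<rho>\<close> by (auto simp: mem invertible_def)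
    then have "invertible B" "reorder_matrix \<rho> B = B"
      unfolding invertible_def
      using reorder_matrix_fixes_inverse[OF assms] \<open>A \<in> GL_state_symmetry \<rho>\<close> mem by blast+
    then show ?thesis
      using B(2) mem by blast
  qed
qed

end
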